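(* Let $X$ be a real Hilbert space, let $f\colon X\to\mathbb{R}$ be convex and continuous with $C=\{x\in X : f(x)\le 0\}\neq\varnothing$, let $s\colon X\to X$ be a selection of $\partial f$, and let $G\colon X\to X$ be the associated subgradient projector. If $Gx\in\operatorname{conv}(\{x\}\cup C)$ for every $x\in X$, then $f$ has the decreasing property.
   Context: A selection of the convex subdifferential $\partial f$ is a map $s\colon X\to X$ with $s(x)\in\partial f(x)$ for all $x$. The subgradient projector associated with $f$ and $s$ is $G=G_s\colon X\to X$, $G_sx=x-\frac{f(x)}{\|s(x)\|^2}s(x)$ if $f(x)>0$, and $G_sx=x$ otherwise. Set $\mathcal{G}x=\{G_s x: s\text{ is a selection of }\partial f\}$. The function $f$ has the decreasing property if $\sup f(\mathcal{G}x)\le f(x)$ for all $x\in X$. *)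

theory Defs
  imports "HOL-Analysis.Analysis" "HOL-Library.Extended_Real"
begin

definition subdifferential :: "('a::real_inner \<Rightarrow> real) \<Rightarrow> 'a \<Rightarrow> 'a set" where
  "subdifferential f x = {u. \<forall>y. u \<bullet> (y - x) + f x \<le> f y}"

definition is_selection :: "('a::real_inner \<Rightarrow> real) \<Rightarrow> ('a \<Rightarrow> 'a) \<Rightarrow> bool" where
  "is_selection f s \<longleftrightarrow> (\<forall>x. s x \<in> subdifferential f x)"

definition subgradient_projector ::
    "('a::real_inner \<Rightarrow> real) \<Rightarrow> ('a \<Rightarrow> 'a) \<Rightarrow> 'a \<Rightarrow> 'a" where
  "subgradient_projector f s x =
     (if f x > 0 then x - (f x / (norm (s x))\<^sup>2) *\<^sub>R s x else x)"

definition subgradient_projections :: "('a::real_inner \<Rightarrow> real) \<Rightarrow> 'a \<Rightarrow> 'a set" where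
  "subgradient_projections f x = {subgradient_projector f s x | s. is_selection f s}"

text \<open>
  The supremum is taken in the extended reals, because the real-valued supremum
  is unspecified on sets that are not bounded above.
\<close>

definition decreasing_property :: "('a::real_inner \<Rightarrow> real) \<Rightarrow> bool" where
  "decreasing_property f \<longleftrightarrow>
     (\<forall>x. (SUP y\<in>subgradient_projections f x. ereal (f y)) \<le> ereal (f x))"

end

theory Submission
  imports Defs
begin

text \<open>
  If f x > 0, the hypothesis only says that the ray from x in the direction -s(x) meets C, for the
  one given selection s.  The point is that every subgradient u at x satisfies
  -u \<in> closure (cone hull (C - x)).  Otherwise the projection theorem provides a direction v in the
  polar cone of C - x with \<open>u \<bullet> v < 0\<close>.  Monotonicity of the subdifferential gives
  \<open>s(x - t v) \<bullet> v \<le> u \<bullet> v\<close> for t > 0, so the step from x - t v to G (x - t v) moves along v by an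
  amount bounded below uniformly as t tends to 0, whereas membership in the convex hull bounds it
  by \<open>t \<parallel>v\<parallel>\<^sup>2\<close>.  Finally, if -u is approximated by directions k pointing from x into C, then f at
  \<open>x + (f x / (-(u \<bullet> k))) k\<close> is at most f x by convexity, and this passes to the limit.
\<close>

section \<open>Projection onto closed convex sets in Hilbert spaces\<close>

text \<open>The parallelogram identity forces near-minimisers of the distance to \<open>z\<close> to
  cluster: the closed nested sets \<open>T n\<close> have diameters tending to 0, so completeness
  yields a common point, without compactness.\<close>

lemma closest_point_exists_complete:
  fixes S :: "'a::{real_inner, complete_space} set"
  assumes "convex S" "closed S" "S \<noteq> {}"
  obtains p where "p \<in> S" "\<forall>y\<in>S. dist z p \<le> dist z y"
proof -
  define d where "d = infdist z S"
  define T where "T n = S \<inter> cball z (d + 1 / real (Suc n))" for n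
  have dle: "d \<le> dist z y" if "y \<in> S" for y
    using that by (simp add: d_def infdist_le)
  have d0: "d \<ge> 0" by (simp add: d_def infdist_nonneg)
  have diam: "(dist x y)\<^sup>2 \<le> 4 * (2 * d + 1) / real (Suc n)" if "x \<in> T n" "y \<in> T n" for x y n
  proof -
    define r where "r = 1 / real (Suc n)"
    have r: "0 < r" "r \<le> 1" by (auto simp: r_def)
    have x: "x \<in> S" "norm (z - x) \<le> d + r" and y: "y \<in> S" "norm (z - y) \<le> d + r"
      using that by (auto simp: T_def r_def dist_norm)
    define m where "m = (1/2) *\<^sub>R x + (1/2) *\<^sub>R y"
    have "m \<in> S" unfolding m_def using assms(1) x y by (intro convexD) auto
    then have m: "d\<^sup>2 \<le> (norm (z - m))\<^sup>2"
      using dle d0 by (simp add: dist_norm power_mono)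
    have x2: "(norm (z - x))\<^sup>2 \<le> (d + r)\<^sup>2" and y2: "(norm (z - y))\<^sup>2 \<le> (d + r)\<^sup>2"
      using x y by (auto intro!: power_mono)
    \<comment> \<open>Parallelogram identity for \<open>z - x\<close> and \<open>z - y\<close>,
      whose sum is \<open>2 *\<^sub>R (z - m)\<close>; convexity keeps the midpoint \<open>m\<close>
      in \<open>S\<close>, at distance at least \<open>d\<close>.\<close>
    have "(norm (x - y))\<^sup>2 = 2 * (norm (z - x))\<^sup>2 + 2 * (norm (z - y))\<^sup>2 - 4 * (norm (z - m))\<^sup>2"
      unfolding m_def power2_norm_eq_inner
      by (simp add: inner_simps inner_commute field_simps)
    also have "\<dots> \<le> 4 * (d + r)\<^sup>2 - 4 * d\<^sup>2" using m x2 y2 by linarith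
    also have "\<dots> = 4 * (2 * d + r) * r" by (simp add: power2_eq_square algebra_simps)
    also have "\<dots> \<le> 4 * (2 * d + 1) * r" using r d0 by (intro mult_right_mono) auto
    finally show ?thesis by (simp add: r_def dist_norm)
  qed
  obtain p where p: "\<And>n. p \<in> T n"
  proof (rule decreasing_closed_nest[of T])
    show "closed (T n)" for n using assms(2) by (auto simp: T_def)
    show "T n \<noteq> {}" for n
    proof -
      have "infdist z S < d + 1 / real (Suc n)" by (simp add: d_def)
      then obtain a where "a \<in> S" "dist z a < d + 1 / real (Suc n)"
        using assms(3) by (auto simp: infdist_notempty cINF_less_iff)
      then show ?thesis by (auto simp: T_def)
    qed
    show "T n \<subseteq> T m" if "m \<le> n" for m n
      using that frac_le[of 1 1 "real (Suc m)" "real (Suc n)"] by (auto simp: T_def)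
    show "\<exists>n. \<forall>x\<in>T n. \<forall>y\<in>T n. dist x y < e" if "e > 0" for e
    proof -
      obtain n where n: "4 * (2 * d + 1) / e\<^sup>2 < real n"
        using reals_Archimedean2 by blast
      have "4 * (2 * d + 1) < real (Suc n) * e\<^sup>2"
        using n \<open>e > 0\<close> by (simp add: field_simps) (smt (verit) zero_le_power2)
      then have "4 * (2 * d + 1) / real (Suc n) < e\<^sup>2"
        by (simp add: field_simps)
      then show ?thesis
        using diam[of _ n] \<open>e > 0\<close> by (meson le_less_trans less_imp_le power2_less_imp_less)
    qed
  qed blast
  have "dist z p \<le> d"
  proof (rule field_le_epsilon)
    fix e :: real assume "e > 0"
    then obtain n where "1 / real (Suc n) < e" using nat_approx_posE by blast
    then show "dist z p \<le> d + e" using p[of n] by (auto simp: T_def)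
  qed
  then show thesis using that[of p] p[of 0] dle by (force simp: T_def)
qed

text \<open>The residual \<open>v = z - p\<close> of the projection \<open>p\<close> of
  \<open>z\<close> onto \<open>K\<close> works: testing the obtuse-angle inequality at 0 and at
  twice \<open>p\<close> gives both signs, so \<open>v\<close> is orthogonal to
  \<open>p\<close>.\<close>

lemma closed_convex_cone_polar:
  fixes K :: "'a::{real_inner, complete_space} set"
  assumes "convex K" "closed K" "cone K" "K \<noteq> {}" "z \<notin> K"
  obtains v where "\<And>k. k \<in> K \<Longrightarrow> v \<bullet> k \<le> 0" "v \<bullet> z > 0"
proof -
  obtain p where p: "p \<in> K" "\<forall>y\<in>K. dist z p \<le> dist z y"
    using closest_point_exists_complete assms by metis
  define v where "v = z - p"
  have dot: "v \<bullet> (k - p) \<le> 0" if "k \<in> K" for k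
    unfolding v_def using any_closest_point_dot[OF assms(1,2) p(1) that p(2)] .
  have "0 \<in> K" "2 *\<^sub>R p \<in> K"
    using assms(3) p(1) mem_cone[of K p 0] mem_cone[of K p 2] by auto
  from this[THEN dot] have vp: "v \<bullet> p = 0" by (simp add: inner_simps)
  have "v \<noteq> 0" using p(1) assms(5) by (auto simp: v_def)
  then have "v \<bullet> v > 0" by simp
  then have "v \<bullet> z > 0" using vp by (simp add: v_def inner_simps)
  moreover have "v \<bullet> k \<le> 0" if "k \<in> K" for k
    using dot[OF that] vp by (simp add: inner_simps)
  ultimately show thesis using that by blast
qed

section \<open>Subgradients\<close>

lemma subdifferentialD:
  "u \<in> subdifferential f x \<Longrightarrow> u \<bullet> (y - x) + f x \<le> f y"
  by (auto simp: subdifferential_def)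

lemma subdifferential_monotone:
  assumes "u \<in> subdifferential f x" "w \<in> subdifferential f y"
  shows "(u - w) \<bullet> (x - y) \<ge> 0"
  using subdifferentialD[OF assms(1), of y] subdifferentialD[OF assms(2), of x]
  by (simp add: inner_simps)

text \<open>Test the subgradient inequality at distance \<open>r\<close> from \<open>y\<close> in
  the direction \<open>w\<close>. For \<open>w = 0\<close>, division by zero makes the test point
  \<open>y\<close> itself, which still gives 0 \<le> \<open>b\<close>.\<close>

lemma subgradient_norm_le:
  assumes "w \<in> subdifferential f y" "r \<ge> 0" "\<And>z. dist z y \<le> r \<Longrightarrow> f z \<le> f y + b"
  shows "r * norm w \<le> b"
proof -
  define z where "z = y + (r / norm w) *\<^sub>R w"
  have "dist z y \<le> r" using assms(2) by (simp add: z_def dist_norm)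
  then have "w \<bullet> (z - y) \<le> b"
    using assms(3)[of z] subdifferentialD[OF assms(1), of z] by simp
  then show ?thesis
    by (cases "w = 0") (simp_all add: z_def dot_square_norm power2_eq_square)
qed

lemma minus_subgradient_in_closure_cone:
  fixes f :: "'a::{real_inner, complete_space} \<Rightarrow> real"
  assumes cf: "convex_on UNIV f" and cont: "isCont f x"
    and C: "C = {x. f x \<le> 0}" "C \<noteq> {}"
    and s: "is_selection f s"
    and G: "\<And>y. subgradient_projector f s y \<in> convex hull ({y} \<union> C)"
    and fx: "f x > 0" and u: "u \<in> subdifferential f x"
  shows "- u \<in> closure (cone hull ((\<lambda>c. c - x) ` C))" (is "_ \<in> closure ?K")
proof (rule ccontr)
  assume notin: "- u \<notin> closure ?K"
  have convC: "convex C"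
  proof (rule convexI)
    fix a b :: 'a and p q :: real
    assume h: "a \<in> C" "b \<in> C" "0 \<le> p" "0 \<le> q" "p + q = 1"
    then have "f (p *\<^sub>R a + q *\<^sub>R b) \<le> p * f a + q * f b"
      using cf by (auto simp: convex_on_def)
    also have "\<dots> \<le> 0" using h C(1) by (simp add: add_nonpos_nonpos mult_nonneg_nonpos)
    finally show "p *\<^sub>R a + q *\<^sub>R b \<in> C" by (simp add: C(1))
  qed
  have cK: "convex (closure ?K)"
    using convC by (intro convex_closure convex_cone_hull) simp
  have "cone (closure ?K)" "closure ?K \<noteq> {}"
    using C(2) by (simp_all add: cone_closure cone_cone_hull flip: cone_hull_empty_iff)
  then obtain v where v: "\<And>k. k \<in> closure ?K \<Longrightarrow> v \<bullet> k \<le> 0" and "v \<bullet> (- u) > 0"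
    using closed_convex_cone_polar[OF cK closed_closure] notin by metis
  define a where "a = v \<bullet> (- u)"
  have a: "a > 0" using \<open>v \<bullet> (- u) > 0\<close> by (simp add: a_def)
  have vC: "v \<bullet> (c - x) \<le> 0" if "c \<in> C" for c
    using that by (intro v closure_subset[THEN subsetD] hull_inc) auto
  \<comment> \<open>The radius is doubled so that the \<open>r\<close>-ball around any
    \<open>y\<close> within \<open>r\<close> of \<open>x\<close> stays where \<open>f\<close>
    deviates from \<open>f x\<close> by less than half of \<open>f x\<close>.\<close>
  obtain r where r: "r > 0" and fr: "\<And>y. dist y x < 2 * r \<Longrightarrow> \<bar>f y - f x\<bar> < f x / 2"
  proof -
    obtain \<delta> where "\<delta> > 0" "\<And>y. dist y x < \<delta> \<Longrightarrow> \<bar>f y - f x\<bar> < f x / 2"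
      using cont fx unfolding continuous_at_eps_delta dist_real_def by (meson half_gt_zero)
    then show thesis using that[of "\<delta> / 2"] by simp
  qed
  \<comment> \<open>The left side is positive and free of \<open>t\<close>, while the right side
    vanishes with \<open>t\<close>. The factor \<open>(f x / r)\<^sup>2\<close> bounds the squared
    norm of the subgradient at \<open>y\<close>.\<close>
  have step: "a * (f x / 2) \<le> t * (norm v)\<^sup>2 * (f x / r)\<^sup>2" if t: "t > 0" "t * norm v < r" for t
  proof -
    define y where "y = x - t *\<^sub>R v"
    define \<mu> where "\<mu> = f y / (norm (s y))\<^sup>2"
    have dy: "dist y x < r" using t by (simp add: y_def dist_norm)
    then have fy: "f y > f x / 2" using fr[of y] r by linarith
    then have fy0: "f y > 0" using fx by simp
    have sy: "s y \<in> subdifferential f y" using s by (simp add: is_selection_def)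
    have "r * norm (s y) \<le> f x"
    proof (rule subgradient_norm_le[OF sy])
      fix z assume "dist z y \<le> r"
      then have "dist z x < 2 * r" using dy dist_triangle[of z x y] by simp
      then show "f z \<le> f y + f x" using fr[of z] fy by linarith
    qed (use r in simp)
    then have n: "norm (s y) \<le> f x / r" using r by (simp add: field_simps)
    \<comment> \<open>A zero subgradient would make \<open>y\<close> a global minimiser, although
      \<open>f y\<close> is positive and \<open>C\<close> is nonempty.\<close>
    have "s y \<noteq> 0"
    proof
      assume "s y = 0"
      moreover obtain c where "f c \<le> 0" using C by auto
      ultimately show False using subdifferentialD[OF sy, of c] fy0 by simp
    qed
    have vs: "v \<bullet> s y \<le> - a"
    proof -
      have "0 \<le> t * (v \<bullet> (u - s y))"
        using subdifferential_monotone[OF u sy] by (simp add: y_def inner_commute)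
      then have "0 \<le> v \<bullet> (u - s y)" using t(1) by (simp add: zero_le_mult_iff)
      then show ?thesis by (simp add: a_def inner_simps)
    qed
    have "y - \<mu> *\<^sub>R s y \<in> convex hull (insert y C)"
      using G[of y] fy0 by (simp add: subgradient_projector_def \<mu>_def)
    then obtain \<theta> \<eta> c where \<theta>: "\<theta> \<ge> 0" "\<eta> \<ge> 0" "\<eta> + \<theta> = 1" and c: "c \<in> C"
      and eq: "y - \<mu> *\<^sub>R s y = \<eta> *\<^sub>R y + \<theta> *\<^sub>R c"
      using convex_hull_insert[OF C(2)] hull_same[of convex C] convC by auto
    have \<eta>: "\<eta> = 1 - \<theta>" using \<theta> by simp
    \<comment> \<open>The projector step goes a fraction \<open>\<theta>\<close> of the way from
      \<open>y\<close> to \<open>c\<close>. Since \<open>v\<close> is nonpositive on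
      \<open>c - x\<close>, pairing with \<open>v\<close> leaves only the shift from
      \<open>x\<close> to \<open>y\<close>, of size \<open>t * (norm v)\<^sup>2\<close>.\<close>
    have "\<mu> *\<^sub>R s y = \<theta> *\<^sub>R (y - c)" using eq by (simp add: \<eta> algebra_simps)
    then have "\<mu> * (v \<bullet> s y) = \<theta> * (v \<bullet> (y - c))" by (metis inner_scaleR_right)
    moreover have "v \<bullet> (y - c) = - (v \<bullet> (c - x)) - t * (norm v)\<^sup>2"
      by (simp add: y_def inner_simps power2_norm_eq_inner)
    then have "- (v \<bullet> (y - c)) \<le> t * (norm v)\<^sup>2" using vC[OF c] by simp
    then have "\<theta> * (- (v \<bullet> (y - c))) \<le> \<theta> * (t * (norm v)\<^sup>2)"
      using \<theta>(1) by (rule mult_left_mono)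
    moreover have "\<theta> * (t * (norm v)\<^sup>2) \<le> t * (norm v)\<^sup>2"
      using \<theta> t by (intro mult_left_le_one_le) auto
    moreover have "\<mu> * a \<le> \<mu> * (- (v \<bullet> s y))"
      using vs fy0 by (intro mult_left_mono) (auto simp: \<mu>_def)
    ultimately have "\<mu> * a \<le> t * (norm v)\<^sup>2" by simp
    then have "f y * a \<le> t * (norm v)\<^sup>2 * (norm (s y))\<^sup>2"
      using \<open>s y \<noteq> 0\<close> by (simp add: \<mu>_def field_simps)
    also have "\<dots> \<le> t * (norm v)\<^sup>2 * (f x / r)\<^sup>2"
      using n t by (intro mult_left_mono power_mono) auto
    finally have "f y * a \<le> t * (norm v)\<^sup>2 * (f x / r)\<^sup>2" .
    moreover have "a * (f x / 2) \<le> a * f y" using fy a by (intro mult_left_mono) auto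
    ultimately show ?thesis by (simp only: mult.commute[of a "f y"])
  qed
  have "((\<lambda>t. t * norm v) \<longlongrightarrow> 0 * norm v) (at_right 0)"
    by (intro tendsto_intros)
  then have "\<forall>\<^sub>F t in at_right 0. t * norm v < r"
    by (rule order_tendstoD(2)) (use r in simp)
  moreover have "((\<lambda>t. t * (norm v)\<^sup>2 * (f x / r)\<^sup>2) \<longlongrightarrow> 0 * (norm v)\<^sup>2 * (f x / r)\<^sup>2) (at_right 0)"
    by (intro tendsto_intros)
  then have "\<forall>\<^sub>F t in at_right 0. t * (norm v)\<^sup>2 * (f x / r)\<^sup>2 < a * (f x / 2)"
    by (rule order_tendstoD(2)) (use a fx in simp)
  ultimately have "\<forall>\<^sub>F t in at_right (0::real). False"
    using eventually_at_right_less[of "0::real"]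
    by eventually_elim (use step in fastforce)
  then show False by simp
qed

text \<open>The chosen step length is where the linearization of \<open>f\<close> at
  \<open>x\<close> vanishes along \<open>k\<close>. That linearization lies below \<open>f\<close>,
  hence is nonpositive at \<open>c\<close>, so the point reached lies on the segment from
  \<open>x\<close> to \<open>c\<close>.\<close>

lemma convex_along_cone_le:
  assumes cf: "convex_on UNIV f" and fx: "f x > 0" and u: "u \<in> subdifferential f x"
    and k: "k \<in> cone hull ((\<lambda>c. c - x) ` {c. f c \<le> 0})" and uk: "u \<bullet> k < 0"
  shows "f (x + (f x / - (u \<bullet> k)) *\<^sub>R k) \<le> f x"
proof -
  obtain l c where l: "l \<ge> 0" and c: "f c \<le> 0" and keq: "k = l *\<^sub>R (c - x)"
    using k by (auto simp: cone_hull_expl)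
  define \<tau> where "\<tau> = f x / - (u \<bullet> k) * l"
  have "f x \<le> - (u \<bullet> (c - x))" using subdifferentialD[OF u, of c] c by simp
  then have "l * f x \<le> l * - (u \<bullet> (c - x))" using l by (rule mult_left_mono)
  then have "l * f x \<le> - (u \<bullet> k)" by (simp add: keq)
  then have \<tau>: "0 \<le> \<tau>" "\<tau> \<le> 1"
    using uk l fx by (auto simp: \<tau>_def divide_nonneg_pos field_simps)
  have "x + (f x / - (u \<bullet> k)) *\<^sub>R k = (1 - \<tau>) *\<^sub>R x + \<tau> *\<^sub>R c"
    by (simp add: \<tau>_def keq algebra_simps)
  then have "f (x + (f x / - (u \<bullet> k)) *\<^sub>R k) \<le> (1 - \<tau>) * f x + \<tau> * f c"
    using convex_onD[OF cf \<tau>] by simp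
  also have "\<dots> \<le> f x"
    using mult_left_mono[of "f c" "f x" \<tau>] \<tau> c fx by (simp add: algebra_simps)
  finally show ?thesis .
qed

theorem proposition9p1:
  fixes f :: "'a::{real_inner, complete_space} \<Rightarrow> real"
    and s G :: "'a \<Rightarrow> 'a"
    and C :: "'a set"
  assumes "convex_on UNIV f"
    and "continuous_on UNIV f"
    and "C = {x. f x \<le> 0}"
    and "C \<noteq> {}"
    and "is_selection f s"
    and "G = subgradient_projector f s"
    and "\<And>x. G x \<in> convex hull ({x} \<union> C)"
  shows "decreasing_property f"
proof -
  have cont: "isCont f x" for x
    using assms(2) by (simp add: continuous_on_eq_continuous_at)
  have "f (subgradient_projector f s' x) \<le> f x" if s': "is_selection f s'" for s' x
  proof (cases "f x > 0")
    case fx: True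
    define u where "u = s' x"
    have u: "u \<in> subdifferential f x" using s' by (simp add: u_def is_selection_def)
    obtain c where "f c \<le> 0" using assms(3,4) by auto
    then have "u \<noteq> 0" using subdifferentialD[OF u, of c] fx by auto
    have "- u \<in> closure (cone hull ((\<lambda>c. c - x) ` C))"
      using minus_subgradient_in_closure_cone[OF assms(1) cont assms(3-5) _ fx u] assms(6,7) by simp
    then obtain k where k: "\<And>n. k n \<in> cone hull ((\<lambda>c. c - x) ` C)" and lim: "k \<longlonglongrightarrow> - u"
      by (auto simp: closure_sequential)
    have "(\<lambda>n. u \<bullet> k n) \<longlonglongrightarrow> u \<bullet> (- u)" by (intro tendsto_intros lim)
    moreover have "u \<bullet> (- u) < 0" using \<open>u \<noteq> 0\<close> by simp
    ultimately have "\<forall>\<^sub>F n in sequentially. u \<bullet> k n < 0" by (rule order_tendstoD(2))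
    then have "\<forall>\<^sub>F n in sequentially. f (x + (f x / - (u \<bullet> k n)) *\<^sub>R k n) \<le> f x"
      by eventually_elim (use convex_along_cone_le[OF assms(1) fx u] k assms(3) in blast)
    \<comment> \<open>At the limit direction \<open>- u\<close> the step length becomes
      \<open>f x / (u \<bullet> u)\<close>, so the limit point is the projector's value;
      \<open>u\<close> being nonzero keeps the quotient continuous there.\<close>
    moreover have "(\<lambda>n. f (x + (f x / - (u \<bullet> k n)) *\<^sub>R k n))
        \<longlonglongrightarrow> f (x + (f x / - (u \<bullet> (- u))) *\<^sub>R (- u))"
      using \<open>u \<noteq> 0\<close> by (intro isCont_tendsto_compose[OF cont] tendsto_intros lim) auto
    ultimately have "f (x + (f x / - (u \<bullet> (- u))) *\<^sub>R (- u)) \<le> f x"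
      using tendsto_upperbound by (metis trivial_limit_sequentially)
    then show ?thesis
      using fx by (simp add: subgradient_projector_def u_def power2_norm_eq_inner)
  qed (simp add: subgradient_projector_def)
  then show ?thesis
    by (auto simp: decreasing_property_def subgradient_projections_def intro!: SUP_least)
qed

end
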